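(* Let $(X,d)$ be a complete separable metric space, let $\mathfrak m$ be a Borel, locally finite, non-negative measure on $X$ with $\operatorname{supp}\mathfrak m=X$, and let $\bar x\in X$. Assume that $(X,d,\mathfrak m,\bar x)$ is a pointed measured-Gromov-Hausdorff limit of a sequence of pointed complete $n$-dimensional Riemannian manifolds $\{(M_i,g_i,\bar x_i)\}_{i\in\mathbb N}$ with $\mathrm{Ric}_{(M_i,g_i)}\ge-(n-1)$. Let $T^*X$ be the Cheeger-Colding cotangent bundle of $X$ with its canonical scalar product $\langle\cdot,\cdot\rangle_x$ on the fibers. Then for every pair of locally Lipschitz functions $f,g:X\to\mathbb R$, $$\langle \mathrm df,\mathrm dg\rangle_x=Df\cdot Dg\,(x)\qquad\text{for }\mathfrak m\text{-a.e. }x\in X.$$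
   Context: Locally finite means that every $x\in X$ has a neighborhood of finite $\mathfrak m$-measure. The manifolds $M_i$ are regarded as metric measure spaces with the Riemannian distance and the renormalized Riemannian volume measure, $\mathrm{vol}_{g_i}/\mathrm{vol}_{g_i}(B_1(\bar x_i))$. Slope: for $f:X\to\mathbb R$, $|Df|(x):=\limsup_{y\to x}\frac{|f(y)-f(x)|}{d(y,x)}$ if $x$ is not isolated, and $|Df|(x):=0$ if $x$ is isolated. For $f,g:X\to\mathbb R$ with finite slopes, the functions $D^{\pm}f(\nabla g):X\to\mathbb R$ are defined pointwise by $$D^{+}f(\nabla g):=\liminf_{\varepsilon\downarrow0}\frac{|D(g+\varepsilon f)|^2-|Dg|^2}{2\varepsilon},\qquad D^{-}f(\nabla g):=\limsup_{\varepsilon\uparrow0}\frac{|D(g+\varepsilon f)|^2-|Dg|^2}{2\varepsilon}$$ on $\{|Dg|\neq0\}$, and are $0$ by definition on $\{|Dg|=0\}$. Known fact: such a limit space is Lipschitz-infinitesimally Hilbertian, i.e. for all Lipschitz $f,g:X\to\mathbb R$ the functions $D^+f(\nabla g)$, $D^-f(\nabla g)$, $D^+g(\nabla f)$, $D^-g(\nabla f)$ agree $\mathfrak m$-a.e.; their common value is denoted $Df\cdot Dg$. The same notation is used for locally Lipschitz functions, since all these quantities are local. Cotangent bundle (Cheeger, Cheeger-Colding): the limit space admits a cotangent bundle $T^*X$ with the following known properties. (1) $T^*X$ is a topological space. (2) There is a Borel map $\pi:T^*X\to X$ with $\mathfrak m(X\setminus\pi(T^*X))=0$. (3) For every $x\in\pi(T^*X)$,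 $\pi^{-1}(x)$ is a finite-dimensional real vector space with a canonical scalar product $\langle\cdot,\cdot\rangle_x$. (4) For every open $U\subset X$ and every Lipschitz function $f$ on $U$ there exist a Borel set $V\subset U$ with $\mathfrak m(U\setminus V)=0$ and a Borel map $\mathrm df:V\to T^*X$ (the differential of $f$) such that $\pi\circ\mathrm df(x)=x$ and $|\mathrm df|(x)=|Df|(x)$ for every $x\in V$, where $|v|(x)=\sqrt{\langle v,v\rangle_x}$. (5) For every open $U\subset X$ and Lipschitz functions $f,g$ on $U$ whose differentials $\mathrm df,\mathrm dg$ are defined on $V\subset U$ with $\mathfrak m(U\setminus V)=0$ as in (4), for all $\alpha,\beta\in\mathbb R$ the differential of $\alpha f+\beta g$ is defined on $V$ and $\mathrm d(\alpha f+\beta g)(x)=\alpha\,\mathrm df(x)+\beta\,\mathrm dg(x)$ for every $x\in V$. Differentials are compatible ($\mathfrak m$-a.e.) with restriction to smaller open sets, and for a locally Lipschitz function $f$ the differential $\mathrm df$ is defined $\mathfrak m$-a.e. by covering $X$ with countably many open sets on which $f$ is Lipschitz. *)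

theory Defs
  imports "HOL-Analysis.Analysis"
begin

section \<open>Riemannian manifolds of dimension \<open>CARD('n)\<close>\<close>

definition pderiv_axis :: "'n::finite \<Rightarrow> (real^'n \<Rightarrow> real) \<Rightarrow> real^'n \<Rightarrow> real" where
  "pderiv_axis i h x = frechet_derivative h (at x) (axis i 1)"

primrec Ck_on :: "nat \<Rightarrow> (real^'n::finite) set \<Rightarrow> (real^'n \<Rightarrow> real) \<Rightarrow> bool" where
  "Ck_on 0 S h \<longleftrightarrow> continuous_on S h"
| "Ck_on (Suc k) S h \<longleftrightarrow>
     (\<forall>x\<in>S. h differentiable (at x)) \<and> (\<forall>i. Ck_on k S (pderiv_axis i h))"

definition Cinf_on :: "(real^'n::finite) set \<Rightarrow> (real^'n \<Rightarrow> real) \<Rightarrow> bool" where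
  "Cinf_on S h \<longleftrightarrow> (\<forall>k. Ck_on k S h)"

text \<open>A chart is a pair of its domain and its coordinate map; the coordinate map is meaningful
  only on the domain. The metric tensor is given by its Gram matrix in each chart of the atlas,
  as a function of the coordinates. The atlas need not be maximal.\<close>

type_synonym ('b, 'n) chart = "'b set \<times> ('b \<Rightarrow> real^'n)"

record ('b, 'n::finite) riemannian =
  mtop :: "'b topology"
  atlas :: "('b, 'n) chart set"
  gram :: "('b, 'n) chart \<Rightarrow> real^'n \<Rightarrow> real^'n^'n"

definition transition :: "('b, 'n::finite) chart \<Rightarrow> ('b, 'n) chart \<Rightarrow> real^'n \<Rightarrow> real^'n" where
  "transition c c' = snd c' \<circ> inv_into (fst c) (snd c)"

definition riemannian_manifold :: "('b, 'n::finite) riemannian \<Rightarrow> bool" where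
  "riemannian_manifold M \<longleftrightarrow>
     topspace (mtop M) \<noteq> {} \<and> Hausdorff_space (mtop M) \<and> second_countable (mtop M) \<and>
     connected_space (mtop M) \<and>
     (\<Union>(U, \<phi>)\<in>atlas M. U) = topspace (mtop M) \<and>
     (\<forall>(U, \<phi>)\<in>atlas M. openin (mtop M) U \<and> open (\<phi> ` U) \<and>
        homeomorphic_map (subtopology (mtop M) U) (top_of_set (\<phi> ` U)) \<phi>) \<and>
     (\<forall>c\<in>atlas M. \<forall>c'\<in>atlas M. \<forall>i.
        Cinf_on (snd c ` (fst c \<inter> fst c')) (\<lambda>x. transition c c' x $ i)) \<and>
     (\<forall>c\<in>atlas M. \<forall>i j. Cinf_on (snd c ` fst c) (\<lambda>x. gram M c x $ i $ j)) \<and>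
     (\<forall>c\<in>atlas M. \<forall>x\<in>snd c ` fst c.
        transpose (gram M c x) = gram M c x \<and> (\<forall>v. v \<noteq> 0 \<longrightarrow> 0 < v \<bullet> (gram M c x *v v))) \<and>
     (\<forall>c\<in>atlas M. \<forall>c'\<in>atlas M. \<forall>x\<in>snd c ` (fst c \<inter> fst c').
        let J = matrix (frechet_derivative (transition c c') (at x))
        in gram M c x = transpose J ** gram M c' (transition c c' x) ** J)"

text \<open>Piecewise \<open>C\<^sup>1\<close> curves are defined as in the library (\<^term>\<open>(piecewise_C1_differentiable_on)\<close>):
  continuous, and continuously differentiable off a finite set of parameters. One-sided derivatives
  at the exceptional parameters are not required; such curves may have infinite length, and the
  infimum of lengths is the same as over curves that are \<open>C\<^sup>1\<close> up to the break points.\<close>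

definition piecewise_C1_curve :: "('b, 'n::finite) riemannian \<Rightarrow> (real \<Rightarrow> 'b) \<Rightarrow> bool" where
  "piecewise_C1_curve M \<gamma> \<longleftrightarrow> pathin (mtop M) \<gamma> \<and>
     (\<exists>S. finite S \<and> (\<forall>(U, \<phi>)\<in>atlas M.
        (\<phi> \<circ> \<gamma>) C1_differentiable_on {t \<in> {0<..<1} - S. \<gamma> t \<in> U}))"

text \<open>The speed does not depend on the chosen chart, by the transformation law of the metric.\<close>

definition speed :: "('b, 'n::finite) riemannian \<Rightarrow> (real \<Rightarrow> 'b) \<Rightarrow> real \<Rightarrow> real" where
  "speed M \<gamma> t =
     (let c = (SOME c. c \<in> atlas M \<and> \<gamma> t \<in> fst c);
          v = vector_derivative (snd c \<circ> \<gamma>) (at t)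
      in sqrt (v \<bullet> (gram M c (snd c (\<gamma> t)) *v v)))"

definition curve_length :: "('b, 'n::finite) riemannian \<Rightarrow> (real \<Rightarrow> 'b) \<Rightarrow> ennreal" where
  "curve_length M \<gamma> = (\<integral>\<^sup>+t\<in>{0..1}. ennreal (speed M \<gamma> t) \<partial>lborel)"

definition rdist :: "('b, 'n::finite) riemannian \<Rightarrow> 'b \<Rightarrow> 'b \<Rightarrow> real" where
  "rdist M x y =
     enn2real (INF \<gamma>\<in>{\<gamma>. piecewise_C1_curve M \<gamma> \<and> \<gamma> 0 = x \<and> \<gamma> 1 = y}. curve_length M \<gamma>)"

definition complete_riemannian :: "('b, 'n::finite) riemannian \<Rightarrow> bool" where
  "complete_riemannian M \<longleftrightarrow>
     riemannian_manifold M \<and> Metric_space.mcomplete (topspace (mtop M)) (rdist M)"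

definition is_riemannian_volume :: "('b, 'n::finite) riemannian \<Rightarrow> 'b measure \<Rightarrow> bool" where
  "is_riemannian_volume M \<mu> \<longleftrightarrow>
     space \<mu> = topspace (mtop M) \<and>
     sets \<mu> = sigma_sets (topspace (mtop M)) {U. openin (mtop M) U} \<and>
     (\<forall>c\<in>atlas M. \<forall>A\<in>sets \<mu>. A \<subseteq> fst c \<longrightarrow>
        emeasure \<mu> A = (\<integral>\<^sup>+x\<in>snd c ` A. ennreal (sqrt (det (gram M c x))) \<partial>lborel))"

text \<open>On a Riemannian manifold there is exactly one such measure: it is determined by its values in
  charts because countably many of them cover the manifold.\<close>

definition rvol :: "('b, 'n::finite) riemannian \<Rightarrow> 'b measure" where
  "rvol M = (THE \<mu>. is_riemannian_volume M \<mu>)"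

definition normalized_rvol :: "('b, 'n::finite) riemannian \<Rightarrow> 'b \<Rightarrow> 'b measure" where
  "normalized_rvol M p =
     scale_measure (1 / emeasure (rvol M) (Metric_space.mball (topspace (mtop M)) (rdist M) p 1))
       (rvol M)"

text \<open>\<open>christoffel M c k i j\<close> is \<open>\<Gamma>\<^sup>k\<^sub>i\<^sub>j\<close>; the sign of \<open>ricci\<close> is the one for which round
  spheres have positive Ricci curvature.\<close>

definition christoffel ::
  "('b, 'n::finite) riemannian \<Rightarrow> ('b, 'n) chart \<Rightarrow> 'n \<Rightarrow> 'n \<Rightarrow> 'n \<Rightarrow> real^'n \<Rightarrow> real" where
  "christoffel M c k i j x =
     (\<Sum>l\<in>UNIV. matrix_inv (gram M c x) $ k $ l *
        (pderiv_axis i (\<lambda>y. gram M c y $ j $ l) x + pderiv_axis j (\<lambda>y. gram M c y $ i $ l) x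
         - pderiv_axis l (\<lambda>y. gram M c y $ i $ j) x)) / 2"

definition ricci ::
  "('b, 'n::finite) riemannian \<Rightarrow> ('b, 'n) chart \<Rightarrow> real^'n \<Rightarrow> real^'n^'n" where
  "ricci M c x = (\<chi> j k.
     (\<Sum>i\<in>UNIV. pderiv_axis i (christoffel M c i j k) x - pderiv_axis k (christoffel M c i j i) x)
     + (\<Sum>i\<in>UNIV. \<Sum>l\<in>UNIV. christoffel M c i i l x * christoffel M c l j k x
                          - christoffel M c i k l x * christoffel M c l i j x))"

definition ricci_bounded_below :: "('b, 'n::finite) riemannian \<Rightarrow> real \<Rightarrow> bool" where
  "ricci_bounded_below M K \<longleftrightarrow>
     (\<forall>c\<in>atlas M. \<forall>x\<in>snd c ` fst c. \<forall>v.
        v \<bullet> (ricci M c x *v v) \<ge> K * (v \<bullet> (gram M c x *v v)))"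

section \<open>Pointed measured Gromov--Hausdorff convergence\<close>

text \<open>The spaces \<open>(S i, d i, \<mu> i, p i)\<close> converge to the space \<open>(UNIV, dist, m, q)\<close>: there are
  Borel approximations \<open>F i\<close>, relevant only on the balls \<open>B (R i) (p i)\<close>, whose errors \<open>e i\<close> tend
  to \<open>0\<close> while \<open>R i\<close> tends to infinity, and the pushed forward measures converge weakly against
  continuous bounded functions with bounded support.\<close>

definition pmGH_limit ::
  "(nat \<Rightarrow> 'b set) \<Rightarrow> (nat \<Rightarrow> 'b \<Rightarrow> 'b \<Rightarrow> real) \<Rightarrow> (nat \<Rightarrow> 'b measure) \<Rightarrow> (nat \<Rightarrow> 'b) \<Rightarrow>
   'a::metric_space measure \<Rightarrow> 'a \<Rightarrow> bool" where
  "pmGH_limit S d \<mu> p m q \<longleftrightarrow>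
     (\<exists>R e F. filterlim R at_top sequentially \<and> e \<longlonglongrightarrow> 0 \<and>
       (\<forall>i. R i > 0 \<and> e i > 0 \<and>
         (let B = Metric_space.mball (S i) (d i) (p i) (R i) in
           F i \<in> borel_measurable (restrict_space (\<mu> i) B) \<and>
           F i (p i) = q \<and>
           (\<forall>x\<in>B. \<forall>y\<in>B. \<bar>dist (F i x) (F i y) - d i x y\<bar> \<le> e i) \<and>
           (\<forall>y\<in>ball q (R i - e i). \<exists>x\<in>B. dist (F i x) y \<le> e i))) \<and>
       (\<forall>h :: 'a \<Rightarrow> real. continuous_on UNIV h \<and> bounded (range h) \<and> bounded {x. h x \<noteq> 0} \<longrightarrow>
         (\<lambda>i. LINT x:Metric_space.mball (S i) (d i) (p i) (R i)|\<mu> i. h (F i x))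
           \<longlonglongrightarrow> (LINT x|m. h x)))"

definition ricci_limit ::
  "(nat \<Rightarrow> ('b, 'n::finite) riemannian) \<Rightarrow> (nat \<Rightarrow> 'b) \<Rightarrow> 'a::metric_space measure \<Rightarrow> 'a \<Rightarrow> bool"
  where
  "ricci_limit M p m q \<longleftrightarrow>
     (\<forall>i. complete_riemannian (M i) \<and> p i \<in> topspace (mtop (M i)) \<and>
          ricci_bounded_below (M i) (- (real CARD('n) - 1))) \<and>
     pmGH_limit (\<lambda>i. topspace (mtop (M i))) (\<lambda>i. rdist (M i)) (\<lambda>i. normalized_rvol (M i) (p i)) p
       m q"

section \<open>Slopes and Lipschitz functions\<close>

definition locally_finite_measure :: "'a::topological_space measure \<Rightarrow> bool" where
  "locally_finite_measure m \<longleftrightarrow> (\<forall>x. \<exists>U. open U \<and> x \<in> U \<and> emeasure m U < \<infinity>)"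

definition msupport :: "'a::topological_space measure \<Rightarrow> 'a set" where
  "msupport m = {x. \<forall>U. open U \<and> x \<in> U \<longrightarrow> emeasure m U > 0}"

definition lipschitz_fun_on :: "'a::metric_space set \<Rightarrow> ('a \<Rightarrow> real) \<Rightarrow> bool" where
  "lipschitz_fun_on U f \<longleftrightarrow> (\<exists>L. L-lipschitz_on U f)"

definition locally_lipschitz :: "('a::metric_space \<Rightarrow> real) \<Rightarrow> bool" where
  "locally_lipschitz f \<longleftrightarrow> (\<forall>x. \<exists>U. open U \<and> x \<in> U \<and> lipschitz_fun_on U f)"

text \<open>An open singleton is an isolated point.\<close>

definition local_slope :: "('a::metric_space \<Rightarrow> real) \<Rightarrow> 'a \<Rightarrow> ereal" where
  "local_slope f x =
     (if open {x} then 0 else Limsup (at x) (\<lambda>y. ereal (\<bar>f y - f x\<bar> / dist y x)))"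

definition Dplus :: "('a::metric_space \<Rightarrow> real) \<Rightarrow> ('a \<Rightarrow> real) \<Rightarrow> 'a \<Rightarrow> ereal" where
  "Dplus f g x = (if local_slope g x = 0 then 0 else
     Liminf (at_right 0) (\<lambda>\<epsilon>::real.
       ((local_slope (\<lambda>y. g y + \<epsilon> * f y) x)\<^sup>2 - (local_slope g x)\<^sup>2) / ereal (2 * \<epsilon>)))"

definition Dminus :: "('a::metric_space \<Rightarrow> real) \<Rightarrow> ('a \<Rightarrow> real) \<Rightarrow> 'a \<Rightarrow> ereal" where
  "Dminus f g x = (if local_slope g x = 0 then 0 else
     Limsup (at_left 0) (\<lambda>\<epsilon>::real.
       ((local_slope (\<lambda>y. g y + \<epsilon> * f y) x)\<^sup>2 - (local_slope g x)\<^sup>2) / ereal (2 * \<epsilon>)))"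

text \<open>\<open>has_grad_dot f g x r\<close>: the four quantities \<open>D\<^sup>+f(\<nabla>g)\<close>, \<open>D\<^sup>-f(\<nabla>g)\<close>, \<open>D\<^sup>+g(\<nabla>f)\<close>,
  \<open>D\<^sup>-g(\<nabla>f)\<close> agree at \<open>x\<close>, and their common value \<open>Df \<cdot> Dg (x)\<close> is \<open>r\<close>.\<close>

definition has_grad_dot ::
  "('a::metric_space \<Rightarrow> real) \<Rightarrow> ('a \<Rightarrow> real) \<Rightarrow> 'a \<Rightarrow> real \<Rightarrow> bool" where
  "has_grad_dot f g x r \<longleftrightarrow>
     Dplus f g x = ereal r \<and> Dminus f g x = ereal r \<and>
     Dplus g f x = ereal r \<and> Dminus g f x = ereal r"

section \<open>Cotangent bundles\<close>

locale fin_dim_inner_space =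
  fixes V :: "'e set" and zero :: 'e and add :: "'e \<Rightarrow> 'e \<Rightarrow> 'e"
    and scale :: "real \<Rightarrow> 'e \<Rightarrow> 'e" and ip :: "'e \<Rightarrow> 'e \<Rightarrow> real"
  assumes zero_closed: "zero \<in> V"
    and add_closed: "\<lbrakk>v \<in> V; w \<in> V\<rbrakk> \<Longrightarrow> add v w \<in> V"
    and scale_closed: "v \<in> V \<Longrightarrow> scale a v \<in> V"
    and add_assoc: "\<lbrakk>u \<in> V; v \<in> V; w \<in> V\<rbrakk> \<Longrightarrow> add (add u v) w = add u (add v w)"
    and add_commute: "\<lbrakk>v \<in> V; w \<in> V\<rbrakk> \<Longrightarrow> add v w = add w v"
    and add_zero: "v \<in> V \<Longrightarrow> add zero v = v"
    and add_inverse: "v \<in> V \<Longrightarrow> add v (scale (-1) v) = zero"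
    and scale_add_right: "\<lbrakk>v \<in> V; w \<in> V\<rbrakk> \<Longrightarrow> scale a (add v w) = add (scale a v) (scale a w)"
    and scale_add_left: "v \<in> V \<Longrightarrow> scale (a + b) v = add (scale a v) (scale b v)"
    and scale_scale: "v \<in> V \<Longrightarrow> scale a (scale b v) = scale (a * b) v"
    and scale_one: "v \<in> V \<Longrightarrow> scale 1 v = v"
    and finite_dim: "\<exists>bs. set bs \<subseteq> V \<and> (\<forall>v\<in>V. \<exists>cs. length cs = length bs \<and>
          v = foldr (\<lambda>(a, b) w. add (scale a b) w) (zip cs bs) zero)"
    and ip_commute: "\<lbrakk>v \<in> V; w \<in> V\<rbrakk> \<Longrightarrow> ip v w = ip w v"
    and ip_add: "\<lbrakk>u \<in> V; v \<in> V; w \<in> V\<rbrakk> \<Longrightarrow> ip (add u v) w = ip u w + ip v w"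
    and ip_scale: "\<lbrakk>v \<in> V; w \<in> V\<rbrakk> \<Longrightarrow> ip (scale a v) w = a * ip v w"
    and ip_pos: "\<lbrakk>v \<in> V; v \<noteq> zero\<rbrakk> \<Longrightarrow> 0 < ip v v"

text \<open>The total space is the type \<open>'e\<close>. The operations on the fibre over \<open>x\<close> and its scalar
  product carry \<open>x\<close> as an argument and are meaningful on that fibre only. \<open>differential T U f\<close> is
  the differential of \<open>f\<close> on the open set \<open>U\<close>, a partial map whose domain is the set of points of
  \<open>U\<close> at which the differential is defined.\<close>

record ('a, 'e) cotangent =
  base :: "'e \<Rightarrow> 'a"
  fzero :: "'a \<Rightarrow> 'e"
  fadd :: "'a \<Rightarrow> 'e \<Rightarrow> 'e \<Rightarrow> 'e"
  fscale :: "'a \<Rightarrow> real \<Rightarrow> 'e \<Rightarrow> 'e"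
  fip :: "'a \<Rightarrow> 'e \<Rightarrow> 'e \<Rightarrow> real"
  differential :: "'a set \<Rightarrow> ('a \<Rightarrow> real) \<Rightarrow> 'a \<rightharpoonup> 'e"

text \<open>The bundle is described by its characteristic properties. The image of \<open>base T\<close> need not be
  Borel, so its complement is required to be contained in a null set. The rule
  \<open>differential_local\<close> expresses that \<open>differential T U f\<close> depends on \<open>f\<close> as a function on
  \<open>U\<close> only.\<close>

locale cotangent_bundle =
  fixes m :: "'a::metric_space measure" and T :: "('a, 'e::topological_space) cotangent"
  assumes base_borel: "base T \<in> borel_measurable borel"
    and base_almost_onto: "AE x in m. x \<in> range (base T)"
    and fibre: "x \<in> range (base T) \<Longrightarrow>
          fin_dim_inner_space (base T -` {x}) (fzero T x) (fadd T x) (fscale T x) (fip T x)"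
    and differential_domain: "\<lbrakk>open U; lipschitz_fun_on U f\<rbrakk> \<Longrightarrow>
          dom (differential T U f) \<subseteq> U \<and> dom (differential T U f) \<in> sets borel \<and>
          emeasure m (U - dom (differential T U f)) = 0"
    and differential_borel: "\<lbrakk>open U; lipschitz_fun_on U f\<rbrakk> \<Longrightarrow>
          (\<lambda>x. the (differential T U f x))
            \<in> borel_measurable (restrict_space borel (dom (differential T U f)))"
    and differential_base: "\<lbrakk>open U; lipschitz_fun_on U f; differential T U f x = Some v\<rbrakk> \<Longrightarrow>
          base T v = x"
    and differential_norm: "\<lbrakk>open U; lipschitz_fun_on U f; differential T U f x = Some v\<rbrakk> \<Longrightarrow>
          ereal (sqrt (fip T x v v)) = local_slope f x"
    and differential_linear: "\<lbrakk>open U; lipschitz_fun_on U f; lipschitz_fun_on U g;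
          differential T U f x = Some v; differential T U g x = Some w\<rbrakk> \<Longrightarrow>
          differential T U (\<lambda>y. a * f y + b * g y) x
            = Some (fadd T x (fscale T x a v) (fscale T x b w))"
    and differential_local: "\<lbrakk>open U; lipschitz_fun_on U f; \<And>x. x \<in> U \<Longrightarrow> f x = g x\<rbrakk> \<Longrightarrow>
          differential T U f = differential T U g"
    and differential_restrict: "\<lbrakk>open U; open U'; U' \<subseteq> U; lipschitz_fun_on U f\<rbrakk> \<Longrightarrow>
          AE x in m. x \<in> U' \<longrightarrow> differential T U' f x = differential T U f x"

text \<open>The differential of a locally Lipschitz function on the whole space is determined only
  almost everywhere. \<open>is_differential m T f \<omega>\<close> says that \<open>\<omega>\<close> is a representative of it.\<close>

definition is_differential ::
  "'a::metric_space measure \<Rightarrow> ('a, 'e) cotangent \<Rightarrow> ('a \<Rightarrow> real) \<Rightarrow> ('a \<Rightarrow> 'e) \<Rightarrow> bool" where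
  "is_differential m T f \<omega> \<longleftrightarrow>
     (\<exists>U :: nat \<Rightarrow> 'a set. (\<forall>k. open (U k) \<and> lipschitz_fun_on (U k) f) \<and> (\<Union>k. U k) = UNIV \<and>
        (\<forall>k. AE x in m. x \<in> U k \<longrightarrow> differential T (U k) f x = Some (\<omega> x)))"

lemma lipschitz_fun_on_subset: "lipschitz_fun_on U f \<Longrightarrow> V \<subseteq> U \<Longrightarrow> lipschitz_fun_on V f"
  unfolding lipschitz_fun_on_def by (meson lipschitz_on_subset)

lemma (in cotangent_bundle) AE_differential_defined:
  assumes "sets m = sets borel" "open U" "lipschitz_fun_on U f"
  shows "AE x in m. x \<in> U \<longrightarrow> (\<exists>v. differential T U f x = Some v)"
proof -
  have "U - dom (differential T U f) \<in> null_sets m"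
    using differential_domain[OF assms(2,3)] assms(1,2) by (auto intro!: null_setsI)
  then show ?thesis
    by (rule AE_I') auto
qed

lemma (in cotangent_bundle) differential_exists_aux:
  fixes f :: "'a \<Rightarrow> real"
  assumes "sets m = sets borel" and "locally_lipschitz f"
    and sc: "\<exists>B :: 'a set set. countable B \<and> topological_basis B"
  shows "\<exists>\<omega>. is_differential m T f \<omega>"
proof -
  obtain B :: "'a set set" where B: "countable B" "topological_basis B" using sc by blast
  define C where "C = {V \<in> B. lipschitz_fun_on V f}"
  have C: "countable (insert {} C)" using B(1) by (auto simp: C_def)
  have opn: "open V" if "V \<in> insert {} C" for V
    using that B(2) by (auto simp: C_def topological_basis_open)
  have lip: "lipschitz_fun_on V f" if "V \<in> insert {} C" for V
    using that by (auto simp: C_def lipschitz_fun_on_def intro: lipschitz_intros)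
  define U where "U = from_nat_into (insert {} C)"
  have U: "U k \<in> insert {} C" for k
    unfolding U_def by (rule from_nat_into) simp
  have cov: "(\<Union>k. U k) = UNIV"
  proof -
    have "x \<in> \<Union>(insert {} C)" for x
    proof -
      obtain W where W: "open W" "x \<in> W" "lipschitz_fun_on W f"
        using assms(2) by (auto simp: locally_lipschitz_def)
      then obtain V where "V \<in> B" "x \<in> V" "V \<subseteq> W"
        using topological_basisE[OF B(2)] by metis
      then show ?thesis using lipschitz_fun_on_subset[OF W(3)] by (auto simp: C_def)
    qed
    moreover have "range U = insert {} C"
      unfolding U_def using C by (simp add: range_from_nat_into)
    ultimately show ?thesis by auto
  qed
  define j where "j x = (LEAST k. x \<in> U k)" for x
  have j: "x \<in> U (j x)" for x
    unfolding j_def using cov by (metis LeastI_ex UNIV_I UN_iff)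
  define \<omega> where "\<omega> x = the (differential T (U (j x)) f x)" for x
  have "AE x in m. \<forall>k l. (x \<in> U k \<longrightarrow> (\<exists>v. differential T (U k) f x = Some v)) \<and>
      (x \<in> U k \<inter> U l \<longrightarrow> differential T (U k \<inter> U l) f x = differential T (U k) f x) \<and>
      (x \<in> U k \<inter> U l \<longrightarrow> differential T (U k \<inter> U l) f x = differential T (U l) f x)"
    unfolding AE_all_countable
    using AE_differential_defined[OF assms(1) opn[OF U] lip[OF U]]
      differential_restrict[OF opn[OF U] open_Int[OF opn[OF U] opn[OF U]] Int_lower1 lip[OF U]]
      differential_restrict[OF opn[OF U] open_Int[OF opn[OF U] opn[OF U]] Int_lower2 lip[OF U]]
    by (intro allI AE_conjI) blast+
  then have "AE x in m. \<forall>k. x \<in> U k \<longrightarrow> differential T (U k) f x = Some (\<omega> x)"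
  proof (rule AE_mp, intro AE_I2 impI allI)
    fix x k
    assume H: "\<forall>k l. (x \<in> U k \<longrightarrow> (\<exists>v. differential T (U k) f x = Some v)) \<and>
      (x \<in> U k \<inter> U l \<longrightarrow> differential T (U k \<inter> U l) f x = differential T (U k) f x) \<and>
      (x \<in> U k \<inter> U l \<longrightarrow> differential T (U k \<inter> U l) f x = differential T (U l) f x)" and x: "x \<in> U k"
    then have "differential T (U k) f x = differential T (U (j x)) f x"
      using j[of x] by (metis IntI)
    then show "differential T (U k) f x = Some (\<omega> x)"
      using H j[of x] unfolding \<omega>_def by (metis option.sel)
  qed
  then show ?thesis
    unfolding is_differential_def AE_all_countable using opn[OF U] lip[OF U] cov by blast
qed

text \<open>Every locally Lipschitz function has a differential in this sense.\<close>

lemma differential_exists: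
  fixes m :: "'a::polish_space measure"
  assumes "cotangent_bundle m T" "sets m = sets borel" "locally_lipschitz f"
  shows "\<exists>\<omega>. is_differential m T f \<omega>"
  using cotangent_bundle.differential_exists_aux[OF assms] ex_countable_basis by blast

end

theory Submission
  imports Defs
begin

text \<open>The identity is pointwise. Where \<open>df\<close> and \<open>dg\<close> are defined on a common open set, linearity
  and the norm identity make the squared slope of \<open>g + \<epsilon> f\<close> the quadratic polynomial
  \<open>|dg|\<^sup>2 + 2 \<epsilon> \<langle>df, dg\<rangle> + \<epsilon>\<^sup>2 |df|\<^sup>2\<close> in \<open>\<epsilon>\<close>, whose difference quotients at \<open>0\<close> converge to
  \<open>2 \<langle>df, dg\<rangle>\<close> from both sides. Where \<open>|Dg| = 0\<close>, the convention \<open>D\<^sup>\<plusminus>f(\<nabla>g) = 0\<close> is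
  consistent because \<open>dg\<close> vanishes there.\<close>

context fin_dim_inner_space
begin

lemma ip_zero_left: "w \<in> V \<Longrightarrow> ip zero w = 0"
  using ip_add[OF zero_closed zero_closed, of w] add_zero[OF zero_closed] by simp

lemma ip_zero_right: "w \<in> V \<Longrightarrow> ip w zero = 0"
  using ip_zero_left ip_commute zero_closed by metis

lemma ip_nonneg: "v \<in> V \<Longrightarrow> 0 \<le> ip v v"
  using ip_pos[of v] ip_zero_left[OF zero_closed] by (cases "v = zero") auto

lemma ip_eq_zero_iff: "v \<in> V \<Longrightarrow> ip v v = 0 \<longleftrightarrow> v = zero"
  using ip_pos[of v] ip_zero_left[OF zero_closed] by (cases "v = zero") auto

lemma ip_lincomb_self:
  assumes "v \<in> V" "w \<in> V"
  shows "ip (add (scale a v) (scale b w)) (add (scale a v) (scale b w))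
    = a\<^sup>2 * ip v v + 2 * a * b * ip v w + b\<^sup>2 * ip w w"
proof -
  note closed = assms scale_closed[OF assms(1)] scale_closed[OF assms(2)]
  have left: "ip (add (scale a v) (scale b w)) u = a * ip v u + b * ip w u" if "u \<in> V" for u
    using that closed by (simp add: ip_add ip_scale)
  \<comment> \<open>The axioms give linearity in the first argument only; symmetry carries it to the
    second.\<close>
  have right: "ip u (add (scale a v) (scale b w)) = a * ip u v + b * ip u w" if "u \<in> V" for u
    using left[OF that] that closed by (simp add: ip_commute add_closed)
  show ?thesis
    using closed
    by (simp add: left right add_closed ip_commute[of w v] power2_eq_square algebra_simps)
qed

end

lemma lipschitz_fun_on_lincomb:
  assumes "lipschitz_fun_on U f" "lipschitz_fun_on U g"
  shows "lipschitz_fun_on U (\<lambda>y. a * f y + b * g y)"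
  using assms unfolding lipschitz_fun_on_def
  by (elim exE) (rule exI, rule lipschitz_on_add; rule lipschitz_on_cmult_real; assumption)

text \<open>\<open>nonneg\<close> lets squaring undo the root, and \<open>degenerate\<close> makes C
  agree with the value 0 prescribed where the slope of g vanishes.\<close>

lemma Dplus_Dminus_eqI:
  fixes f g :: "'a::metric_space \<Rightarrow> real"
  assumes slope: "\<And>\<epsilon>. local_slope (\<lambda>y. g y + \<epsilon> * f y) x = ereal (sqrt (B + 2 * \<epsilon> * C + \<epsilon>\<^sup>2 * A))"
    and nonneg: "\<And>\<epsilon>. 0 \<le> B + 2 * \<epsilon> * C + \<epsilon>\<^sup>2 * A"
    and degenerate: "B = 0 \<Longrightarrow> C = 0"
  shows "Dplus f g x = ereal C" "Dminus f g x = ereal C"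
proof -
  have slope_g: "local_slope g x = ereal (sqrt B)" and "0 \<le> B"
    using slope[of 0] nonneg[of 0] by simp_all
  let ?q = "\<lambda>\<epsilon>. ((local_slope (\<lambda>y. g y + \<epsilon> * f y) x)\<^sup>2 - (local_slope g x)\<^sup>2) / ereal (2 * \<epsilon>)"
  have q: "?q \<epsilon> = ereal (C + \<epsilon> * A / 2)" if "\<epsilon> \<noteq> 0" for \<epsilon>
    using that nonneg[of \<epsilon>] \<open>0 \<le> B\<close>
    by (simp add: slope slope_g power2_eq_square field_simps flip: real_sqrt_mult)
  \<comment> \<open>A general S covers \<open>at_right 0\<close> and \<open>at_left 0\<close> at
    once. Both omit 0, the only point where \<open>q\<close> may fail.\<close>
  have lim: "((\<lambda>\<epsilon>. ereal (C + \<epsilon> * A / 2)) \<longlongrightarrow> ereal C) (at 0 within S)" for S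
    by (auto intro!: tendsto_eq_intros)
  have lim_q: "(?q \<longlongrightarrow> ereal C) (at 0 within S)" for S
    by (rule tendsto_cong[THEN iffD2, OF _ lim]) (use q in \<open>auto simp: eventually_at_filter\<close>)
  show "Dplus f g x = ereal C"
    using degenerate lim_imp_Liminf[OF _ lim_q] \<open>0 \<le> B\<close> by (auto simp: Dplus_def slope_g)
  show "Dminus f g x = ereal C"
    using degenerate lim_imp_Limsup[OF _ lim_q] \<open>0 \<le> B\<close> by (auto simp: Dminus_def slope_g)
qed

context cotangent_bundle
begin

lemma local_slope_lincomb:
  assumes "open U" "lipschitz_fun_on U f" "lipschitz_fun_on U g"
    and "differential T U f x = Some v" "differential T U g x = Some w"
  shows "local_slope (\<lambda>y. a * f y + b * g y) x
    = ereal (sqrt (a\<^sup>2 * fip T x v v + 2 * a * b * fip T x v w + b\<^sup>2 * fip T x w w))"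
proof -
  have base: "base T v = x" "base T w = x"
    using differential_base assms by blast+
  interpret fin_dim_inner_space "base T -` {x}" "fzero T x" "fadd T x" "fscale T x" "fip T x"
    using fibre base by blast
  show ?thesis
    using differential_norm[OF assms(1) lipschitz_fun_on_lincomb[OF assms(2,3)]
        differential_linear[OF assms]] base
    by (simp add: ip_lincomb_self)
qed

lemma has_grad_dot_fip:
  assumes "open U" "lipschitz_fun_on U f" "lipschitz_fun_on U g"
    and "differential T U f x = Some v" "differential T U g x = Some w"
  shows "has_grad_dot f g x (fip T x v w)"
proof -
  have base: "v \<in> base T -` {x}" "w \<in> base T -` {x}"
    using differential_base assms by blast+
  interpret fin_dim_inner_space "base T -` {x}" "fzero T x" "fadd T x" "fscale T x" "fip T x"
    using fibre base by blast
  \<comment> \<open>The polynomial is the scalar product of a fibre vector with itself.\<close>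
  have nonneg: "0 \<le> a\<^sup>2 * fip T x v v + 2 * a * b * fip T x v w + b\<^sup>2 * fip T x w w" for a b
    using ip_lincomb_self[OF base] ip_nonneg add_closed scale_closed base by metis
  note slope = local_slope_lincomb[OF assms]
  \<comment> \<open>Set b = 1 and let a be the parameter. If the norm of w is 0, then w is the zero
    vector and its product with v vanishes.\<close>
  have "Dplus f g x = ereal (fip T x v w)" "Dminus f g x = ereal (fip T x v w)"
    by (rule Dplus_Dminus_eqI[where A = "fip T x v v" and B = "fip T x w w"],
        use slope[of _ 1] nonneg[of _ 1] ip_eq_zero_iff ip_zero_right base in
          \<open>auto simp: algebra_simps\<close>)+
  \<comment> \<open>The same formula with a = 1 and b as the parameter; now v is the vector that may
    vanish.\<close>
  moreover have "Dplus g f x = ereal (fip T x v w)" "Dminus g f x = ereal (fip T x v w)"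
    by (rule Dplus_Dminus_eqI[where A = "fip T x w w" and B = "fip T x v v"],
        use slope[of 1] nonneg[of 1] ip_eq_zero_iff ip_zero_left base in
          \<open>auto simp: algebra_simps\<close>)+
  ultimately show ?thesis
    by (simp add: has_grad_dot_def)
qed

text \<open>The two representatives may come from different covers, while
  \<open>differential_linear\<close> needs one open set for both functions. Restriction to the
  intersections of the covers supplies it almost everywhere.\<close>

lemma AE_has_grad_dot:
  assumes "is_differential m T f df" "is_differential m T g dg"
  shows "AE x in m. has_grad_dot f g x (fip T x (df x) (dg x))"
proof -
  obtain U where U: "\<And>k. open (U k)" "\<And>k. lipschitz_fun_on (U k) f" "(\<Union>k::nat. U k) = UNIV"
    "\<And>k. AE x in m. x \<in> U k \<longrightarrow> differential T (U k) f x = Some (df x)"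
    using assms(1) unfolding is_differential_def by blast
  obtain W where W: "\<And>l. open (W l)" "\<And>l. lipschitz_fun_on (W l) g" "(\<Union>l::nat. W l) = UNIV"
    "\<And>l. AE x in m. x \<in> W l \<longrightarrow> differential T (W l) g x = Some (dg x)"
    using assms(2) unfolding is_differential_def by blast
  have "AE x in m. x \<in> U k \<inter> W l \<longrightarrow> has_grad_dot f g x (fip T x (df x) (dg x))" for k l
  proof -
    have UW: "open (U k \<inter> W l)" "lipschitz_fun_on (U k \<inter> W l) f" "lipschitz_fun_on (U k \<inter> W l) g"
      using open_Int[OF U(1) W(1)] lipschitz_fun_on_subset[OF U(2) Int_lower1]
        lipschitz_fun_on_subset[OF W(2) Int_lower2] by blast+
    show ?thesis
      using U(4)[of k] W(4)[of l]
        differential_restrict[OF U(1) UW(1) Int_lower1 U(2)]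
        differential_restrict[OF W(1) UW(1) Int_lower2 W(2)]
      by eventually_elim (auto intro: has_grad_dot_fip[OF UW])
  qed
  \<comment> \<open>There are countably many pairs (k, l), so the exceptional null sets can be
    united; each point lies in some intersection because both families cover the space.\<close>
  then have "AE x in m. \<forall>k l. x \<in> U k \<inter> W l \<longrightarrow> has_grad_dot f g x (fip T x (df x) (dg x))"
    unfolding AE_all_countable by blast
  then show ?thesis
    by eventually_elim (use U(3) W(3) in blast)
qed

end

theorem lemma3p7:
  fixes m :: "'a::polish_space measure" and xbar :: 'a
    and M :: "nat \<Rightarrow> ('b, 'n::finite) riemannian" and p :: "nat \<Rightarrow> 'b"
    and T :: "('a, 'e::topological_space) cotangent"
    and f g :: "'a \<Rightarrow> real" and df dg :: "'a \<Rightarrow> 'e"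
  assumes "sets m = sets borel" and "locally_finite_measure m" and "msupport m = UNIV"
    and "ricci_limit M p m xbar"
    and "cotangent_bundle m T"
    and "locally_lipschitz f" and "locally_lipschitz g"
    and "is_differential m T f df" and "is_differential m T g dg"
  shows "AE x in m. has_grad_dot f g x (fip T x (df x) (dg x))"
  using cotangent_bundle.AE_has_grad_dot[OF assms(5,8,9)] .

end
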